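(* Let $K$ be a field, let $\Delta$ be a hypergraph on the vertex set $\{1,\dots,n\}$, and let $R=K[x_1,\dots,x_n]$. Then the vertex cover algebra $A(\Delta,w)$ is a standard graded algebra over $R$ for all weight functions $w:\Delta\to\{1,2,3,\dots\}$ if and only if $\Delta$ is a unimodular hypergraph.
   Context: A hypergraph $\Delta$ on $V=\{1,\dots,n\}$ is a collection of subsets of $V$, called edges; it is assumed throughout that there is no inclusion between different edges of $\Delta$ (i.e. $\Delta$ is a clutter). A weight function is a map $w:F\mapsto w_F$ from $\Delta$ to the set of positive integers. For $k\in\mathbb{N}=\{0,1,2,\dots\}$, a $k$-cover of $(\Delta,w)$ is a vector $\mathbf{c}=(c_1,\dots,c_n)\in\mathbb{N}^n$ such that $\sum_{i\in F}c_i\ge k w_F$ for all $F\in\Delta$. Let $R=K[x_1,\dots,x_n]$ be the polynomial ring over $K$, and write $\mathbf{x}^{\mathbf{c}}=x_1^{c_1}\cdots x_n^{c_n}$. The vertex cover algebra $A(\Delta,w)$ is the subalgebra of the one-variable polynomial ring $R[t]$ generated by all monomials $\mathbf{x}^{\mathbf{c}}t^k$, where $k\ge 0$ and $\mathbf{c}$ is a $k$-cover of $(\Delta,w)$. It is graded over $R$ by the degree in $t$: its degree $k$ component $A(\Delta,w)_k$ is spanned over $K$ by the $\mathbf{x}^{\mathbf{c}}t^k$ with $\mathbf{c}$ a $k$-cover, and $A(\Delta,w)_0=R$. It is called standard graded over $R$ if it is generated as an $R$-algebra by elements of degree one. Write $\Delta=\{F_1,\dots,F_m\}$. The edge-vertex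 incidence matrix of $\Delta$ is the $m\times n$ matrix $M=(e_{ij})$ with $e_{ij}=1$ if $j\in F_i$ and $e_{ij}=0$ if $j\notin F_i$. A matrix is totally unimodular if each of its subdeterminants (determinants of square submatrices) is $0$ or $\pm1$. The hypergraph $\Delta$ is called unimodular if $M$ is totally unimodular. *)

theory Defs
  imports
    "HOL-Library.Poly_Mapping"
    "HOL-Computational_Algebra.Polynomial"
    "Jordan_Normal_Form.Determinant"
    "Jordan_Normal_Form.DL_Submatrix"
begin

section \<open>Hypergraphs and covers\<close>

definition hypergraph :: "nat \<Rightarrow> nat set set \<Rightarrow> bool" where
  "hypergraph n \<Delta> \<longleftrightarrow> \<Delta> \<subseteq> Pow {1..n} \<and> (\<forall>F\<in>\<Delta>. \<forall>G\<in>\<Delta>. F \<subseteq> G \<longrightarrow> F = G)"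

text \<open>A vector of \<open>\<nat>\<^sup>n\<close> is a finitely supported map with support in \<open>{1..n}\<close>, so that it can
  serve directly as an exponent vector of a monomial.\<close>

definition k_cover ::
    "nat \<Rightarrow> nat set set \<Rightarrow> (nat set \<Rightarrow> nat) \<Rightarrow> nat \<Rightarrow> (nat \<Rightarrow>\<^sub>0 nat) \<Rightarrow> bool" where
  "k_cover n \<Delta> w k c \<longleftrightarrow>
     Poly_Mapping.keys c \<subseteq> {1..n} \<and> (\<forall>F\<in>\<Delta>. k * w F \<le> (\<Sum>i\<in>F. Poly_Mapping.lookup c i))"


section \<open>Subalgebras of a polynomial ring in one more variable\<close>

text \<open>Polynomials in the variables \<open>x\<^sub>i\<close>, \<open>i :: nat\<close>: finitely supported maps from exponent
  vectors to coefficients, with the convolution product.\<close>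

type_synonym 'k mpoly = "(nat \<Rightarrow>\<^sub>0 nat) \<Rightarrow>\<^sub>0 'k"

definition monomial :: "(nat \<Rightarrow>\<^sub>0 nat) \<Rightarrow> 'k::comm_ring_1 mpoly" where
  "monomial c = Poly_Mapping.single c 1"

definition polynomial_ring :: "nat \<Rightarrow> 'k::comm_ring_1 mpoly set" where
  "polynomial_ring n = {p. \<forall>c\<in>Poly_Mapping.keys p. Poly_Mapping.keys c \<subseteq> {1..n}}"

text \<open>All algebras below live in the type \<^typ>\<open>'k mpoly poly\<close>, the outer variable being \<open>t\<close>;
  \<^term>\<open>monom r k\<close> is \<open>r t\<^sup>k\<close>. Coefficient rings are represented by their constant polynomials.\<close>

definition subring_of :: "'a::comm_ring_1 set \<Rightarrow> bool" where
  "subring_of S \<longleftrightarrow> 1 \<in> S \<and> (\<forall>a\<in>S. \<forall>b\<in>S. a - b \<in> S \<and> a * b \<in> S)"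

definition subalgebra_generated_by :: "'a::comm_ring_1 set \<Rightarrow> 'a set \<Rightarrow> 'a set" where
  "subalgebra_generated_by B G = subring_of hull (B \<union> G)"

definition field_constants :: "'k::field mpoly poly set" where
  "field_constants = range (\<lambda>a. [:Poly_Mapping.single 0 a:])"

definition polynomial_ring_constants :: "nat \<Rightarrow> 'k::field mpoly poly set" where
  "polynomial_ring_constants n = (\<lambda>r. [:r:]) ` polynomial_ring n"

definition vertex_cover_algebra ::
    "nat \<Rightarrow> nat set set \<Rightarrow> (nat set \<Rightarrow> nat) \<Rightarrow> 'k::field mpoly poly set" where
  "vertex_cover_algebra n \<Delta> w =
     subalgebra_generated_by field_constants {monom (monomial c) k | c k. k_cover n \<Delta> w k c}"

definition graded_component :: "'k::field mpoly poly set \<Rightarrow> nat \<Rightarrow> 'k mpoly poly set" where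
  "graded_component A k = {p \<in> A. \<exists>r. p = monom r k}"

definition standard_graded :: "nat \<Rightarrow> 'k::field mpoly poly set \<Rightarrow> bool" where
  "standard_graded n A \<longleftrightarrow>
     (\<exists>G \<subseteq> graded_component A 1. A = subalgebra_generated_by (polynomial_ring_constants n) G)"


section \<open>Unimodular hypergraphs\<close>

text \<open>Matrix indices start at 0, so column \<open>j\<close> belongs to vertex \<open>j + 1\<close>.\<close>

definition incidence_matrix :: "nat \<Rightarrow> nat set list \<Rightarrow> int mat" where
  "incidence_matrix n Fs = mat (length Fs) n (\<lambda>(i, j). if Suc j \<in> Fs ! i then 1 else 0)"

definition totally_unimodular :: "int mat \<Rightarrow> bool" where
  "totally_unimodular M \<longleftrightarrow>
     (\<forall>I \<subseteq> {..<dim_row M}. \<forall>J \<subseteq> {..<dim_col M}.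
        card I = card J \<longrightarrow> det (submatrix M I J) \<in> {-1, 0, 1})"

text \<open>The choice of the enumeration \<open>F\<^sub>1, \<dots>, F\<^sub>m\<close> is immaterial: another one permutes the rows
  of the incidence matrix and changes subdeterminants at most by a sign.\<close>

definition unimodular_hypergraph :: "nat \<Rightarrow> nat set set \<Rightarrow> bool" where
  "unimodular_hypergraph n \<Delta> \<longleftrightarrow>
     (\<exists>Fs. distinct Fs \<and> set Fs = \<Delta> \<and> totally_unimodular (incidence_matrix n Fs))"

end

theory Submission
  imports Defs
begin

text \<open>Both sides of the equivalence are turned into elementary statements about integer vectors.

  The algebra \<open>A(\<Delta>, w)\<close> is spanned by the monomials \<open>x\<^sup>c t\<^sup>k\<close> with \<open>c\<close> a \<open>k\<close>-cover, and the
  \<open>R\<close>-subalgebra generated by its component of degree one is spanned by those for which \<open>c\<close> is a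
  sum of \<open>k\<close> 1-covers and a 0-cover. So \<open>A(\<Delta>, w)\<close> is standard graded if and only if every
  \<open>k\<close>-cover decomposes in this way (\<open>standard_graded_iff_decomposable\<close>). On the other side, a
  square integer matrix has determinant 0 or \<open>\<plusminus>1\<close> if and only if it has a nonzero real kernel
  vector or maps the integer vectors onto the integer vectors. Total unimodularity thus becomes a
  condition on all pairs \<open>(I, J)\<close> of equally many edges and vertices
  (\<open>unimodular_hypergraph_iff\<close>), in which adding a row and a column needs no expansion of
  determinants.

  If \<open>\<Delta>\<close> is unimodular and \<open>c\<close> is a \<open>k\<close>-cover with \<open>k > 0\<close>, then the real vector \<open>c / k\<close> can be
  rounded to an integer vector \<open>b\<close> in such a way that each coordinate and each edge sum moves to
  one of its two neighbouring integers (\<open>integer_rounding\<close>, a form of the theorem of Hoffman and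
  Kruskal). Since the edge sums of \<open>c / k\<close> are at least \<open>w\<close>, and those of \<open>c - c / k\<close> at least
  \<open>(k - 1) w\<close>, the vector \<open>b\<close> is a 1-cover and \<open>c - b\<close> is a \<open>(k - 1)\<close>-cover. Induction on \<open>k\<close>
  decomposes \<open>c\<close>.

  Conversely, suppose that some pair \<open>(I, J)\<close> violates the condition, and take one with the
  largest possible \<open>J\<close>. Maximality forces \<open>J\<close> to meet every edge. Some integer right-hand side
  \<open>b\<close> has no integer solution on \<open>(I, J)\<close>, but a multiple \<open>k b\<close> has a solution \<open>x\<close>. After adding
  a large constant multiple of \<open>k\<close> to its coordinates, \<open>x\<close> becomes a \<open>k\<close>-cover \<open>c\<close> supported on
  \<open>J\<close>, for the weight \<open>w\<close> that rounds the edge sums of \<open>c / k\<close> down; these weights are positive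
  because \<open>J\<close> meets every edge. The edges in \<open>I\<close> are covered without any slack, so each 1-cover
  in a decomposition of \<open>c\<close> would have edge sum exactly \<open>w F\<close> for all \<open>F \<in> I\<close>; undoing the shift
  would give an integer solution for \<open>b\<close> (\<open>kernel_or_onto_if_decomposable\<close>).\<close>

section \<open>Square integer matrices indexed by finite sets\<close>

text \<open>Real kernel vectors rather than integer ones: the rounding argument applies this to real vectors.\<close>
definition has_kernel :: "('r \<Rightarrow> 'c \<Rightarrow> int) \<Rightarrow> 'r set \<Rightarrow> 'c set \<Rightarrow> bool" where
  "has_kernel a I J \<longleftrightarrow>
     (\<exists>x :: 'c \<Rightarrow> real. (\<exists>j\<in>J. x j \<noteq> 0) \<and> (\<forall>i\<in>I. (\<Sum>j\<in>J. of_int (a i j) * x j) = 0))"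

definition int_onto :: "('r \<Rightarrow> 'c \<Rightarrow> int) \<Rightarrow> 'r set \<Rightarrow> 'c set \<Rightarrow> bool" where
  "int_onto a I J \<longleftrightarrow>
     (\<forall>b :: 'r \<Rightarrow> int. \<exists>x :: 'c \<Rightarrow> int. \<forall>i\<in>I. (\<Sum>j\<in>J. a i j * x j) = b i)"

text \<open>Enumerations \<open>e\<close> of \<open>I\<close> and \<open>f\<close> of \<open>J\<close> turn the array \<open>a\<close> into a square matrix, whose determinant
  decides solvability over the two index sets.\<close>
context
  fixes a :: "'r \<Rightarrow> 'c \<Rightarrow> int" and I :: "'r set" and J :: "'c set"
    and m :: nat and e :: "nat \<Rightarrow> 'r" and f :: "nat \<Rightarrow> 'c"
  assumes e: "bij_betw e {..<m} I" and f: "bij_betw f {..<m} J"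
begin

abbreviation enum_mat :: "int mat" where
  "enum_mat \<equiv> mat m m (\<lambda>(p, q). a (e p) (f q))"

lemma enum_mat_mult_vec:
  fixes x :: "'c \<Rightarrow> 'a::comm_ring_1"
  assumes "p < m"
  shows "(map_mat of_int enum_mat *\<^sub>v vec m (\<lambda>q. x (f q))) $ p = (\<Sum>j\<in>J. of_int (a (e p) j) * x j)"
proof -
  have "(map_mat of_int enum_mat *\<^sub>v vec m (\<lambda>q. x (f q))) $ p
      = (\<Sum>q<m. of_int (a (e p) (f q)) * x (f q))"
    using assms by (simp add: scalar_prod_def atLeast0LessThan)
  also have "\<dots> = (\<Sum>j\<in>J. of_int (a (e p) j) * x j)"
    by (rule sum.reindex_bij_betw[OF f])
  finally show ?thesis .
qed

lemma enum_mat_mult_int_vec: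
  fixes x :: "'c \<Rightarrow> int"
  assumes "p < m"
  shows "(enum_mat *\<^sub>v vec m (\<lambda>q. x (f q))) $ p = (\<Sum>j\<in>J. a (e p) j * x j)"
proof -
  have "map_mat of_int enum_mat = enum_mat"
    by (intro eq_matI) auto
  then show ?thesis
    using enum_mat_mult_vec[OF assms, of x] by simp
qed

lemma vec_as_function:
  assumes "v \<in> carrier_vec m"
  obtains x where "v = vec m (\<lambda>q. x (f q))"
proof
  show "v = vec m (\<lambda>q. (\<lambda>j. v $ inv_into {..<m} f j) (f q))"
    using assms bij_betw_inv_into_left[OF f] by (intro eq_vecI) auto
qed

text \<open>The determinant is the same over the integers and over the reals, and over a field it vanishes
  exactly if there is a kernel vector.\<close>
lemma has_kernel_iff_det: "has_kernel a I J \<longleftrightarrow> det enum_mat = 0"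
proof -
  let ?C = "map_mat real_of_int enum_mat"
  have C: "?C \<in> carrier_mat m m" by simp
  have "det enum_mat = 0 \<longleftrightarrow> det ?C = 0"
    by (simp only: of_int_hom.hom_det of_int_eq_0_iff)
  also have "\<dots> \<longleftrightarrow> (\<exists>v. v \<in> carrier_vec m \<and> v \<noteq> 0\<^sub>v m \<and> ?C *\<^sub>v v = 0\<^sub>v m)"
    by (rule det_0_iff_vec_prod_zero_field[OF C])
  also have "\<dots> \<longleftrightarrow> (\<exists>x. vec m (\<lambda>q. x (f q)) \<noteq> 0\<^sub>v m \<and> ?C *\<^sub>v vec m (\<lambda>q. x (f q)) = 0\<^sub>v m)"
    by (metis vec_as_function vec_carrier)
  also have "\<dots> \<longleftrightarrow> has_kernel a I J"
  proof -
    have "vec m (\<lambda>q. x (f q)) \<noteq> 0\<^sub>v m \<longleftrightarrow> (\<exists>j\<in>J. x j \<noteq> 0)" for x :: "'c \<Rightarrow> real"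
    proof -
      have "vec m (\<lambda>q. x (f q)) = 0\<^sub>v m \<longleftrightarrow> (\<forall>q<m. x (f q) = 0)"
        by (auto simp: vec_eq_iff)
      then show ?thesis
        using bij_betw_imp_surj_on[OF f] by auto
    qed
    moreover have "?C *\<^sub>v vec m (\<lambda>q. x (f q)) = 0\<^sub>v m
        \<longleftrightarrow> (\<forall>i\<in>I. (\<Sum>j\<in>J. of_int (a i j) * x j) = 0)" for x :: "'c \<Rightarrow> real"
    proof -
      have "?C *\<^sub>v vec m (\<lambda>q. x (f q)) = 0\<^sub>v m
          \<longleftrightarrow> (\<forall>p<m. (?C *\<^sub>v vec m (\<lambda>q. x (f q))) $ p = 0)"
        by (auto simp: vec_eq_iff simp del: index_mult_mat_vec)
      also have "\<dots> \<longleftrightarrow> (\<forall>p<m. (\<Sum>j\<in>J. of_int (a (e p) j) * x j) = 0)"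
        using enum_mat_mult_vec[of _ x] by (metis (no_types, lifting))
      also have "\<dots> \<longleftrightarrow> (\<forall>i\<in>I. (\<Sum>j\<in>J. of_int (a i j) * x j) = 0)"
        using bij_betw_imp_surj_on[OF e] by auto
      finally show ?thesis .
    qed
    ultimately show ?thesis
      unfolding has_kernel_def by simp
  qed
  finally show ?thesis by simp
qed

text \<open>The adjugate matrix applied to \<open>b\<close> is a solution, as \<open>B adj(B) = det B\<close>.\<close>
lemma det_multiple_solvable: "\<exists>x. \<forall>i\<in>I. (\<Sum>j\<in>J. a i j * x j) = det enum_mat * b i"
proof -
  let ?B = enum_mat and ?v = "vec m (\<lambda>p. b (e p))"
  have B: "?B \<in> carrier_mat m m" by simp
  note adj = adj_mat[OF B]
  obtain x where x: "adj_mat ?B *\<^sub>v ?v = vec m (\<lambda>q. x (f q))"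
    using vec_as_function[of "adj_mat ?B *\<^sub>v ?v"] adj(1) by auto
  have "?B *\<^sub>v (adj_mat ?B *\<^sub>v ?v) = det ?B \<cdot>\<^sub>v ?v"
  proof -
    have "?B *\<^sub>v (adj_mat ?B *\<^sub>v ?v) = (det ?B \<cdot>\<^sub>m 1\<^sub>m m) *\<^sub>v ?v"
      using adj(2) by (simp flip: assoc_mult_mat_vec[OF B adj(1)])
    also have "\<dots> = det ?B \<cdot>\<^sub>v ?v"
      by (intro eq_vecI) (simp_all add: row_smult row_one)
    finally show ?thesis .
  qed
  then have "(\<Sum>j\<in>J. a (e p) j * x j) = det ?B * b (e p)" if "p < m" for p
    using enum_mat_mult_int_vec[OF that, of x] that unfolding x by simp
  then show ?thesis
    using bij_betw_imp_surj_on[OF e] by blast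
qed

text \<open>If \<open>B\<close> is onto, solving for the unit vectors gives an integer right inverse, so \<open>det B\<close> divides 1.
  Conversely, if \<open>det B = \<plusminus>1\<close>, then the adjugate is an inverse up to sign.\<close>
lemma int_onto_iff_det: "int_onto a I J \<longleftrightarrow> det enum_mat \<in> {-1, 1}"
proof
  let ?B = enum_mat
  assume onto: "int_onto a I J"
  \<comment> \<open>The right-hand sides are the unit vectors, indexed through the enumeration of \<open>I\<close>.\<close>
  have "\<exists>x. \<forall>p<m. (\<Sum>j\<in>J. a (e p) j * x j) = (if p = r then 1 else 0)" for r
  proof -
    obtain x where "\<forall>i\<in>I. (\<Sum>j\<in>J. a i j * x j) = (if inv_into {..<m} e i = r then 1 else 0)"
      using onto[unfolded int_onto_def, rule_format, of "\<lambda>i. if inv_into {..<m} e i = r then 1 else 0"]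
      by blast
    then show ?thesis
      using bij_betw_apply[OF e] bij_betw_inv_into_left[OF e] by (intro exI[of _ x]) auto
  qed
  then obtain x where x: "p < m \<Longrightarrow> (\<Sum>j\<in>J. a (e p) j * x r j) = (if p = r then 1 else 0)" for p r
    by metis
  define X where "X = mat m m (\<lambda>(q, r). x r (f q))"
  have "?B * X = 1\<^sub>m m"
  proof (rule eq_matI)
    fix p r assume "p < dim_row (1\<^sub>m m :: int mat)" "r < dim_col (1\<^sub>m m :: int mat)"
    then have pr: "p < m" "r < m" by simp_all
    have "col X r = vec m (\<lambda>q. x r (f q))"
      using pr unfolding X_def by (intro eq_vecI) auto
    then have "(?B * X) $$ (p, r) = (?B *\<^sub>v vec m (\<lambda>q. x r (f q))) $ p"
      using pr by (simp add: X_def)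
    then show "(?B * X) $$ (p, r) = 1\<^sub>m m $$ (p, r)"
      using enum_mat_mult_int_vec[OF pr(1), of "x r"] x[OF pr(1), of r] pr by simp
  qed (simp_all add: X_def)
  then have "det ?B * det X = 1"
    using det_mult[of ?B m X] by (simp add: X_def)
  then show "det ?B \<in> {-1, 1}"
    by (auto simp: zmult_eq_1_iff)
next
  assume "det enum_mat \<in> {-1, 1}"
  then have sq: "det enum_mat * det enum_mat = 1" by auto
  show "int_onto a I J"
    unfolding int_onto_def
  proof
    fix b :: "'r \<Rightarrow> int"
    show "\<exists>x. \<forall>i\<in>I. (\<Sum>j\<in>J. a i j * x j) = b i"
      using det_multiple_solvable[of "\<lambda>i. det enum_mat * b i"] by (simp add: sq flip: mult.assoc)
  qed
qed

end

lemma obtain_enumerations: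
  fixes I :: "'r set" and J :: "'c set"
  assumes "finite I" "finite J" "card I = card J"
  obtains e f where "bij_betw e {..<card I} I" "bij_betw f {..<card I} J"
  using assms ex_bij_betw_nat_finite[of I] ex_bij_betw_nat_finite[of J]
  by (auto simp: atLeast0LessThan)

text \<open>The multiplier is \<open>(det B)\<^sup>2\<close>, the square serving to make it positive.\<close>
lemma multiple_solvable_if_no_kernel:
  fixes a :: "'r \<Rightarrow> 'c \<Rightarrow> int"
  assumes "finite I" "finite J" "card I = card J" "\<not> has_kernel a I J"
  obtains k :: int where "k > 0" "\<And>b. \<exists>x. \<forall>i\<in>I. (\<Sum>j\<in>J. a i j * x j) = k * b i"
proof -
  obtain e f where ef: "bij_betw e {..<card I} I" "bij_betw f {..<card I} J"
    using obtain_enumerations[OF assms(1-3)] by blast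
  let ?d = "det (enum_mat a (card I) e f)"
  have "?d \<noteq> 0"
    using has_kernel_iff_det[OF ef] assms(4) by blast
  then show ?thesis
  proof (intro that[of "?d * ?d"])
    fix b :: "'r \<Rightarrow> int"
    show "\<exists>x. \<forall>i\<in>I. (\<Sum>j\<in>J. a i j * x j) = ?d * ?d * b i"
      using det_multiple_solvable[OF ef, of a "\<lambda>i. ?d * b i"] by (simp add: mult.assoc)
  qed (auto simp: zero_less_mult_iff)
qed

text \<open>In other words, full column rank yields a nonsingular square submatrix on all columns. Its rows
  are collected one column at a time. Suppose the rows \<open>I\<close> are nonsingular on the columns
  \<open>J\<close>. On \<open>J\<close> and one more column \<open>v\<close> they have a kernel vector \<open>z\<close> with \<open>z v \<noteq> 0\<close>, unique up to
  scaling. Either \<open>z\<close> is in the kernel of all rows, or a row on which it does not vanish can be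
  added to \<open>I\<close>.\<close>
lemma kernel_or_nonsingular_rows:
  fixes a :: "'r \<Rightarrow> 'c \<Rightarrow> int"
  assumes "finite J" "finite T"
  shows "has_kernel a T J \<or> (\<exists>I\<subseteq>T. card I = card J \<and> \<not> has_kernel a I J)"
  using assms(1)
proof (induction J)
  case empty
  show ?case by (intro disjI2 exI[of _ "{}"]) (simp add: has_kernel_def)
next
  case (insert v J)
  have split: "(\<Sum>j\<in>insert v J. of_int (a i j) * x j) = of_int (a i v) * x v + (\<Sum>j\<in>J. of_int (a i j) * x j)"
    for i and x :: "'c \<Rightarrow> real" using insert.hyps by simp
  consider "has_kernel a T J" | I where "I \<subseteq> T" "card I = card J" "\<not> has_kernel a I J"
    using insert.IH by blast
  then show ?case
  proof cases
    case 1
    then obtain x :: "'c \<Rightarrow> real" and l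
      where x: "l \<in> J" "x l \<noteq> 0" "\<forall>i\<in>T. (\<Sum>j\<in>J. of_int (a i j) * x j) = 0"
      unfolding has_kernel_def by blast
    have "(\<Sum>j\<in>insert v J. of_int (a i j) * (x(v := 0)) j) = (\<Sum>j\<in>J. of_int (a i j) * x j)" for i
      unfolding split using insert.hyps by (auto intro!: sum.cong)
    with x insert.hyps have "has_kernel a T (insert v J)"
      unfolding has_kernel_def by (intro exI[of _ "x(v := 0)"] conjI bexI[of _ l]) auto
    then show ?thesis ..
  next
    case 2
    have finI: "finite I" using 2(1) assms(2) finite_subset by blast
    obtain k :: int where k: "k > 0" "\<And>b. \<exists>x. \<forall>i\<in>I. (\<Sum>j\<in>J. a i j * x j) = k * b i"
      using multiple_solvable_if_no_kernel[OF finI insert.hyps(1) 2(2,3)] by metis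
    obtain x :: "'c \<Rightarrow> int" where x: "\<forall>i\<in>I. (\<Sum>j\<in>J. a i j * x j) = k * (- a i v)"
      using k(2)[of "\<lambda>i. - a i v"] by blast
    define z :: "'c \<Rightarrow> real" where "z j = (if j = v then of_int k else of_int (x j))" for j
    have zv: "z v \<noteq> 0" using k(1) by (simp add: z_def)
    have zI: "(\<Sum>j\<in>insert v J. of_int (a i j) * z j) = 0" if "i \<in> I" for i
    proof -
      have "(\<Sum>j\<in>J. of_int (a i j) * z j) = of_int (\<Sum>j\<in>J. a i j * x j)"
        using insert.hyps by (auto simp: z_def intro!: sum.cong)
      also have "\<dots> = - (of_int (a i v) * of_int k)"
        using x that by simp
      finally show ?thesis unfolding split by (simp add: z_def)
    qed
    show ?thesis
    proof (cases "\<forall>i\<in>T. (\<Sum>j\<in>insert v J. of_int (a i j) * z j) = 0")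
      case True
      then show ?thesis using zv unfolding has_kernel_def by blast
    next
      case False
      then obtain r where r: "r \<in> T" "(\<Sum>j\<in>insert v J. of_int (a r j) * z j) \<noteq> 0" by blast
      have "r \<notin> I" using r zI by blast
      have "\<not> has_kernel a (insert r I) (insert v J)"
      proof
        assume "has_kernel a (insert r I) (insert v J)"
        then obtain y :: "'c \<Rightarrow> real" where y: "\<exists>j\<in>insert v J. y j \<noteq> 0"
          "\<forall>i\<in>insert r I. (\<Sum>j\<in>insert v J. of_int (a i j) * y j) = 0"
          unfolding has_kernel_def by blast
        \<comment> \<open>The combination of \<open>y\<close> and \<open>z\<close> that vanishes at \<open>v\<close>, so that the rows \<open>I\<close> annihilate it already on \<open>J\<close>.\<close>
        define u where "u j = z v * y j - y v * z j" for j
        have u_sum: "(\<Sum>j\<in>insert v J. of_int (a i j) * u j) =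
          z v * (\<Sum>j\<in>insert v J. of_int (a i j) * y j) - y v * (\<Sum>j\<in>insert v J. of_int (a i j) * z j)" for i
          unfolding u_def by (simp only: sum_distrib_left flip: sum_subtractf) (simp add: algebra_simps)
        have "u v = 0" by (simp add: u_def)
        have "(\<Sum>j\<in>J. of_int (a i j) * u j) = 0" if "i \<in> I" for i
          using u_sum[of i] zI[OF that] y(2) that \<open>u v = 0\<close> unfolding split by simp
        then have u0: "u j = 0" if "j \<in> J" for j
          using 2(3) that unfolding has_kernel_def by blast
        then have "(\<Sum>j\<in>insert v J. of_int (a r j) * u j) = 0"
          unfolding split using \<open>u v = 0\<close> by simp
        then have "y v = 0"
          using u_sum[of r] y(2) r(2) by simp
        then have "y j = 0" if "j \<in> insert v J" for j
          using u0[of j] that zv by (auto simp: u_def)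
        with y(1) show False by blast
      qed
      moreover have "card (insert r I) = card (insert v J)"
        using \<open>r \<notin> I\<close> finI insert.hyps 2(2) by simp
      ultimately show ?thesis using r(1) 2(1) by (intro disjI2 exI[of _ "insert r I"]) auto
    qed
  qed
qed

section \<open>Total unimodularity without determinants\<close>

abbreviation incidence :: "nat set \<Rightarrow> nat \<Rightarrow> int" where
  "incidence F j \<equiv> of_bool (j \<in> F)"

lemma sum_incidence:
  fixes x :: "nat \<Rightarrow> 'a::comm_ring_1"
  assumes "finite J"
  shows "(\<Sum>j\<in>J. of_int (incidence F j) * x j) = (\<Sum>j\<in>F \<inter> J. x j)"
  using assms by (intro sum.mono_neutral_cong_right) auto

lemma sum_incidence_int:
  fixes x :: "nat \<Rightarrow> int"
  assumes "finite J"
  shows "(\<Sum>j\<in>J. incidence F j * x j) = (\<Sum>j\<in>F \<inter> J. x j)"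
  using sum_incidence[OF assms, where x = x] by simp

lemma det_enum_mat_iff:
  assumes "bij_betw e {..<m} I" "bij_betw f {..<m} J"
  shows "det (enum_mat a m e f) \<in> {-1, 0, 1} \<longleftrightarrow> has_kernel a I J \<or> int_onto a I J"
  using has_kernel_iff_det[OF assms, of a] int_onto_iff_det[OF assms, of a] by auto

lemma bij_betw_pick:
  assumes "finite I"
  shows "bij_betw (pick I) {..<card I} I"
proof (rule bij_betw_imageI)
  show "inj_on (pick I) {..<card I}"
    by (rule inj_onI) (metis lessThan_iff linorder_neq_iff pick_mono_le)
  then show "pick I ` {..<card I} = I"
    using assms pick_in_set_le by (intro card_subset_eq) (auto simp: card_image)
qed

text \<open>Total unimodularity of the matrix \<open>a\<close> with row set \<open>E\<close> and column set \<open>V\<close>.\<close>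
definition kernel_or_onto :: "('r \<Rightarrow> 'c \<Rightarrow> int) \<Rightarrow> 'r set \<Rightarrow> 'c set \<Rightarrow> bool" where
  "kernel_or_onto a E V \<longleftrightarrow>
     (\<forall>I\<subseteq>E. \<forall>J\<subseteq>V. card I = card J \<longrightarrow> has_kernel a I J \<or> int_onto a I J)"

text \<open>The row set \<open>I\<close> of a submatrix corresponds to the edges \<open>Fs ! i\<close>, \<open>i \<in> I\<close>, and its column set \<open>J\<close>
  to the vertices \<open>Suc ` J\<close>.\<close>
lemma totally_unimodular_incidence_matrix_iff:
  assumes "distinct Fs"
  shows "totally_unimodular (incidence_matrix n Fs) \<longleftrightarrow> kernel_or_onto incidence (set Fs) {1..n}"
proof -
  let ?M = "incidence_matrix n Fs" and ?m = "length Fs"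
  let ?good = "\<lambda>I J. has_kernel incidence I J \<or> int_onto incidence I J"
  have dims: "dim_row ?M = ?m" "dim_col ?M = n"
    unfolding incidence_matrix_def by simp_all
  have inj: "inj_on ((!) Fs) I" if "I \<subseteq> {..<?m}" for I
    using assms that by (intro inj_on_nth) auto
  have key: "det (submatrix ?M I J) \<in> {-1, 0, 1} \<longleftrightarrow> ?good ((!) Fs ` I) (Suc ` J)"
    if I: "I \<subseteq> {..<?m}" and J: "J \<subseteq> {..<n}" and IJ: "card I = card J" for I J
  proof -
    have fin: "finite I" "finite J" using I J finite_subset by blast+
    have restr: "{i. i < ?m \<and> i \<in> I} = I" "{j. j < n \<and> j \<in> J} = J" using I J by auto
    have pick_bounds: "pick I p < ?m" "pick J p < n" if "p < card I" for p
      using pick_in_set_le[of p I] pick_in_set_le[of p J] that I J IJ by auto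
    have M: "submatrix ?M I J = enum_mat incidence (card I) ((!) Fs \<circ> pick I) (Suc \<circ> pick J)"
      unfolding submatrix_def dims restr IJ[symmetric]
      by (intro eq_matI) (auto simp: incidence_matrix_def pick_bounds)
    have e: "bij_betw ((!) Fs \<circ> pick I) {..<card I} ((!) Fs ` I)"
      using bij_betw_pick[OF fin(1)] inj[OF I] by (intro bij_betw_trans) (auto simp: bij_betw_def)
    have f: "bij_betw (Suc \<circ> pick J) {..<card I} (Suc ` J)"
      using bij_betw_pick[OF fin(2)] unfolding IJ by (intro bij_betw_trans) (auto simp: bij_betw_def)
    show ?thesis
      unfolding M by (rule det_enum_mat_iff[OF e f])
  qed
  show ?thesis
    unfolding totally_unimodular_def kernel_or_onto_def dims
  proof (intro iffI allI impI)
    fix I J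
    assume tu: "\<forall>I\<subseteq>{..<?m}. \<forall>J\<subseteq>{..<n}. card I = card J \<longrightarrow> det (submatrix ?M I J) \<in> {-1, 0, 1}"
      and I: "I \<subseteq> set Fs" and J: "J \<subseteq> {1..n}" and IJ: "card I = card J"
    have "set Fs = (!) Fs ` {..<?m}" by (auto simp: set_conv_nth)
    then obtain I' where I': "I' \<subseteq> {..<?m}" "I = (!) Fs ` I'"
      using I by (metis subset_imageE)
    have "{1..n} = Suc ` {..<n}" by (simp add: image_Suc_lessThan)
    then obtain J' where J': "J' \<subseteq> {..<n}" "J = Suc ` J'"
      using J by (metis subset_imageE)
    have "card I' = card J'"
      using IJ unfolding I' J' card_image[OF inj[OF I'(1)]] by (simp add: card_image)
    then show "?good I J"
      using tu I'(1) J'(1) key[of I' J'] unfolding I'(2) J'(2) by blast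
  next
    fix I J
    assume ko: "\<forall>I\<subseteq>set Fs. \<forall>J\<subseteq>{1..n}. card I = card J \<longrightarrow> ?good I J"
      and I: "I \<subseteq> {..<?m}" and J: "J \<subseteq> {..<n}" and IJ: "card I = card J"
    have "(!) Fs ` I \<subseteq> set Fs" "Suc ` J \<subseteq> {1..n}" using I J by auto
    moreover have "card ((!) Fs ` I) = card (Suc ` J)"
      using IJ by (simp add: card_image inj[OF I])
    ultimately show "det (submatrix ?M I J) \<in> {-1, 0, 1}"
      using ko key[OF I J IJ] by blast
  qed
qed

lemma hypergraph_finite:
  assumes "hypergraph n \<Delta>"
  shows "finite \<Delta>"
  using assms finite_subset[of \<Delta> "Pow {1..n}"] unfolding hypergraph_def by simp

lemma unimodular_hypergraph_iff:
  assumes "hypergraph n \<Delta>"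
  shows "unimodular_hypergraph n \<Delta> \<longleftrightarrow> kernel_or_onto incidence \<Delta> {1..n}"
proof -
  obtain Fs where "set Fs = \<Delta>" "distinct Fs"
    using finite_distinct_list[OF hypergraph_finite[OF assms]] by blast
  then show ?thesis
    unfolding unimodular_hypergraph_def using totally_unimodular_incidence_matrix_iff by blast
qed

section \<open>Subalgebras spanned by monomials\<close>

text \<open>The \<open>K\<close>-linear span of the monomials \<open>x\<^sup>c t\<^sup>k\<close> with \<open>c \<in> C k\<close>, described through coefficients.\<close>
definition monomial_span :: "(nat \<Rightarrow> (nat \<Rightarrow>\<^sub>0 nat) set) \<Rightarrow> 'k::field mpoly poly set" where
  "monomial_span C = {p. \<forall>k. Poly_Mapping.keys (coeff p k) \<subseteq> C k}"

lemma subring_of_subalgebra_generated_by: "subring_of (subalgebra_generated_by B G)"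
  unfolding subalgebra_generated_by_def
  by (rule hull_in) (auto simp: subring_of_def)

lemma subalgebra_generated_by_least:
  assumes "subring_of S" "B \<subseteq> S" "G \<subseteq> S"
  shows "subalgebra_generated_by B G \<subseteq> S"
  unfolding subalgebra_generated_by_def using assms by (intro hull_minimal) auto

lemma subalgebra_generated_by_superset:
  "B \<subseteq> subalgebra_generated_by B G" "G \<subseteq> subalgebra_generated_by B G"
  unfolding subalgebra_generated_by_def using hull_subset[of "B \<union> G" subring_of] by auto

lemma subring_of_add:
  assumes "subring_of S" "a \<in> S" "b \<in> S"
  shows "a + b \<in> S"
proof -
  have "1 - 1 \<in> S" using assms(1) unfolding subring_of_def by blast
  then have "0 - b \<in> S" using assms unfolding subring_of_def by force
  then have "a - (0 - b) \<in> S" using assms unfolding subring_of_def by blast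
  then show ?thesis by simp
qed

lemma subring_of_zero: "subring_of S \<Longrightarrow> 0 \<in> S"
  unfolding subring_of_def by (metis diff_self)

lemma subring_of_sum:
  assumes "subring_of S" "\<And>i. i \<in> I \<Longrightarrow> f i \<in> S"
  shows "(\<Sum>i\<in>I. f i) \<in> S"
  using assms(2)
  by (induction I rule: infinite_finite_induct)
     (auto intro: subring_of_add[OF assms(1)] subring_of_zero[OF assms(1)])

lemma subring_of_mult: "subring_of S \<Longrightarrow> a \<in> S \<Longrightarrow> b \<in> S \<Longrightarrow> a * b \<in> S"
  unfolding subring_of_def by blast

lemma subring_of_monomial_span:
  assumes "0 \<in> C 0" "\<And>i j c d. c \<in> C i \<Longrightarrow> d \<in> C j \<Longrightarrow> c + d \<in> C (i + j)"
  shows "subring_of (monomial_span C :: 'k::field mpoly poly set)"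
  unfolding subring_of_def
proof (intro conjI ballI)
  show "1 \<in> (monomial_span C :: 'k mpoly poly set)"
  proof -
    have "Poly_Mapping.keys (coeff (1 :: 'k mpoly poly) k) \<subseteq> C k" for k
      using assms(1) by (cases k) (auto simp flip: single_one)
    then show ?thesis unfolding monomial_span_def by blast
  qed
next
  fix p q :: "'k mpoly poly"
  assume p: "p \<in> monomial_span C" and q: "q \<in> monomial_span C"
  have "Poly_Mapping.keys (coeff (p - q) k) \<subseteq> C k" for k
    using p q keys_diff[of "coeff p k" "coeff q k"] unfolding monomial_span_def by fastforce
  then show "p - q \<in> monomial_span C" unfolding monomial_span_def by blast
  have "Poly_Mapping.keys (coeff (p * q) k) \<subseteq> C k" for k
  proof -
    have "Poly_Mapping.keys (coeff p i * coeff q (k - i)) \<subseteq> C k" if "i \<le> k" for i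
    proof
      fix c assume "c \<in> Poly_Mapping.keys (coeff p i * coeff q (k - i))"
      then obtain a b where "c = a + b"
        "a \<in> Poly_Mapping.keys (coeff p i)" "b \<in> Poly_Mapping.keys (coeff q (k - i))"
        using keys_mult[of "coeff p i" "coeff q (k - i)"] by blast
      then show "c \<in> C k"
        using p q assms(2)[of a i b "k - i"] that unfolding monomial_span_def by auto
    qed
    then show ?thesis
      unfolding coeff_mult
      using keys_sum[of "\<lambda>i. coeff p i * coeff q (k - i)" "{..k}"] by fastforce
  qed
  then show "p * q \<in> monomial_span C" unfolding monomial_span_def by blast
qed

lemma monom_monomial_in_monomial_span_iff:
  "(monom (monomial c) k :: 'k::field mpoly poly) \<in> monomial_span C \<longleftrightarrow> c \<in> C k"
  unfolding monomial_span_def monomial_def by (auto simp: coeff_monom)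

lemma poly_mapping_eq_sum_singles:
  "p = (\<Sum>c\<in>Poly_Mapping.keys p. Poly_Mapping.single c (Poly_Mapping.lookup p c))"
  by (intro poly_mapping_eqI)
     (auto simp: lookup_sum lookup_single when_def in_keys_iff sum.delta)

lemma monom_sum: "monom (\<Sum>i\<in>I. f i) k = (\<Sum>i\<in>I. monom (f i) k)"
  by (induction I rule: infinite_finite_induct) (auto simp flip: add_monom)

lemma monomial_span_least:
  fixes S :: "'k::field mpoly poly set"
  assumes "subring_of S" "field_constants \<subseteq> S"
    and "\<And>c k. c \<in> C k \<Longrightarrow> monom (monomial c) k \<in> S"
  shows "monomial_span C \<subseteq> S"
proof
  fix p :: "'k mpoly poly" assume p: "p \<in> monomial_span C"
  have term_in: "monom (Poly_Mapping.single c x) k \<in> S" if "c \<in> C k" for c x k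
  proof -
    have "[:Poly_Mapping.single 0 x:] * monom (monomial c) k = monom (Poly_Mapping.single c x) k"
      by (simp add: monomial_def smult_monom mult_single)
    moreover have "[:Poly_Mapping.single 0 x:] \<in> S"
      using assms(2) unfolding field_constants_def by blast
    ultimately show ?thesis
      using subring_of_mult[OF assms(1) _ assms(3)[OF that]] by metis
  qed
  have "monom (coeff p k) k \<in> S" for k
  proof -
    have "(\<Sum>c\<in>Poly_Mapping.keys (coeff p k).
        monom (Poly_Mapping.single c (Poly_Mapping.lookup (coeff p k) c)) k) \<in> S"
      using p unfolding monomial_span_def by (intro subring_of_sum[OF assms(1)] term_in) auto
    then show ?thesis
      unfolding monom_sum[symmetric] poly_mapping_eq_sum_singles[symmetric] .
  qed
  then have "(\<Sum>k\<le>degree p. monom (coeff p k) k) \<in> S"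
    by (intro subring_of_sum[OF assms(1)])
  then show "p \<in> S" by (simp add: poly_as_sum_of_monoms)
qed

section \<open>Standard gradedness as decomposability of covers\<close>

lemma k_cover_add:
  assumes "k_cover n \<Delta> w i c" "k_cover n \<Delta> w j d"
  shows "k_cover n \<Delta> w (i + j) (c + d)"
  unfolding k_cover_def
proof (intro conjI ballI)
  show "Poly_Mapping.keys (c + d) \<subseteq> {1..n}"
    using assms keys_add[of c d] unfolding k_cover_def by blast
  fix F assume "F \<in> \<Delta>"
  then show "(i + j) * w F \<le> (\<Sum>l\<in>F. Poly_Mapping.lookup (c + d) l)"
    using assms unfolding k_cover_def
    by (simp add: lookup_add sum.distrib add_mult_distrib add_mono)
qed

lemma k_cover_0_iff: "k_cover n \<Delta> w 0 c \<longleftrightarrow> Poly_Mapping.keys c \<subseteq> {1..n}"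
  unfolding k_cover_def by simp

text \<open>The generators are closed under multiplication, since a sum of an \<open>i\<close>-cover and a \<open>j\<close>-cover is an
  \<open>(i + j)\<close>-cover, so the generated algebra is no larger than their linear span.\<close>
lemma vertex_cover_algebra_eq_monomial_span:
  "(vertex_cover_algebra n \<Delta> w :: 'k::field mpoly poly set)
     = monomial_span (\<lambda>k. {c. k_cover n \<Delta> w k c})" (is "_ = monomial_span ?C")
proof (rule antisym)
  show "vertex_cover_algebra n \<Delta> w \<subseteq> (monomial_span ?C :: 'k mpoly poly set)"
    unfolding vertex_cover_algebra_def
  proof (rule subalgebra_generated_by_least)
    show "subring_of (monomial_span ?C :: 'k mpoly poly set)"
      by (rule subring_of_monomial_span) (auto simp: k_cover_0_iff k_cover_add)
    show "field_constants \<subseteq> (monomial_span ?C :: 'k mpoly poly set)"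
    proof
      fix p :: "'k mpoly poly" assume "p \<in> field_constants"
      then obtain a where p: "p = [:Poly_Mapping.single 0 a:]"
        unfolding field_constants_def by blast
      have "Poly_Mapping.keys (coeff p k) \<subseteq> ?C k" for k
        unfolding p by (cases k) (auto simp: k_cover_0_iff)
      then show "p \<in> monomial_span ?C"
        unfolding monomial_span_def by blast
    qed
  qed (auto simp: monom_monomial_in_monomial_span_iff)
  show "(monomial_span ?C :: 'k mpoly poly set) \<subseteq> vertex_cover_algebra n \<Delta> w"
    unfolding vertex_cover_algebra_def
  proof (rule monomial_span_least[OF subring_of_subalgebra_generated_by subalgebra_generated_by_superset(1)])
    fix c k assume "c \<in> ?C k"
    then have "monom (monomial c) k \<in> {monom (monomial c) k :: 'k mpoly poly |c k. k_cover n \<Delta> w k c}"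
      by (intro CollectI exI[of _ c] exI[of _ k]) simp
    then show "(monom (monomial c) k :: 'k mpoly poly) \<in> subalgebra_generated_by field_constants
        {monom (monomial c) k |c k. k_cover n \<Delta> w k c}"
      by (rule subsetD[OF subalgebra_generated_by_superset(2)])
  qed
qed

text \<open>Sums of \<open>k\<close> 1-covers and one 0-cover; the 0-cover accounts for multiplication with elements of
  \<open>R\<close>.\<close>
inductive decomposable ::
    "nat \<Rightarrow> nat set set \<Rightarrow> (nat set \<Rightarrow> nat) \<Rightarrow> nat \<Rightarrow> (nat \<Rightarrow>\<^sub>0 nat) \<Rightarrow> bool"
  for n \<Delta> w where
  decomposable_0: "k_cover n \<Delta> w 0 c \<Longrightarrow> decomposable n \<Delta> w 0 c"
| decomposable_Suc:
    "k_cover n \<Delta> w 1 b \<Longrightarrow> decomposable n \<Delta> w k c \<Longrightarrow> decomposable n \<Delta> w (Suc k) (b + c)"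

lemma k_cover_if_decomposable: "decomposable n \<Delta> w k c \<Longrightarrow> k_cover n \<Delta> w k c"
proof (induction rule: decomposable.induct)
  case (decomposable_Suc b k c)
  then show ?case using k_cover_add[of n \<Delta> w 1 b k c] by simp
qed

lemma decomposable_add:
  assumes "decomposable n \<Delta> w i c" "decomposable n \<Delta> w j d"
  shows "decomposable n \<Delta> w (i + j) (c + d)"
  using assms(1)
proof (induction rule: decomposable.induct)
  case (decomposable_0 c)
  show ?case
    using assms(2)
  proof (induction rule: decomposable.induct)
    case (decomposable_0 d)
    with \<open>k_cover n \<Delta> w 0 c\<close> show ?case
      using k_cover_add[of n \<Delta> w 0 c 0 d] decomposable.decomposable_0[of n \<Delta> w "c + d"] by simp
  next
    case (decomposable_Suc b k d)
    then show ?case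
      using decomposable.decomposable_Suc[of n \<Delta> w b k "c + d"] by (simp add: add.left_commute)
  qed
next
  case (decomposable_Suc b k c)
  then show ?case
    using decomposable.decomposable_Suc[of n \<Delta> w b "k + j" "c + d"] by (simp add: add.assoc)
qed

lemma decomposable_1_iff: "decomposable n \<Delta> w 1 c \<longleftrightarrow> k_cover n \<Delta> w 1 c"
proof
  assume "k_cover n \<Delta> w 1 c"
  moreover have "decomposable n \<Delta> w 0 0"
    by (rule decomposable_0) (simp add: k_cover_0_iff)
  ultimately show "decomposable n \<Delta> w 1 c"
    using decomposable_Suc[of n \<Delta> w c 0 0] by simp
qed (rule k_cover_if_decomposable)

text \<open>The span of the monomials of decomposable covers is a subring that contains \<open>R\<close> and the component
  of degree one, hence all of \<open>A(\<Delta>, w)\<close> if this is standard graded. Conversely, the monomial of a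
  decomposable cover is the product of the monomials of its parts.\<close>
lemma standard_graded_iff_decomposable:
  "standard_graded n (vertex_cover_algebra n \<Delta> w :: 'k::field mpoly poly set)
     \<longleftrightarrow> (\<forall>k c. k_cover n \<Delta> w k c \<longrightarrow> decomposable n \<Delta> w k c)"
    (is "standard_graded n ?A \<longleftrightarrow> ?dec")
proof
  let ?C = "\<lambda>k. {c. k_cover n \<Delta> w k c}" and ?D = "\<lambda>k. {c. decomposable n \<Delta> w k c}"
  note A_eq = vertex_cover_algebra_eq_monomial_span[of n \<Delta> w, where ?'k = 'k]
  let ?R = "polynomial_ring_constants n :: 'k mpoly poly set"
  have R_iff: "[:r:] \<in> ?R \<longleftrightarrow> Poly_Mapping.keys r \<subseteq> ?C 0" for r
    unfolding polynomial_ring_constants_def polynomial_ring_def by (auto simp: k_cover_0_iff)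
  have R_sub: "?R \<subseteq> monomial_span K" if "K 0 = ?C 0" for K
  proof
    fix p :: "'k mpoly poly" assume "p \<in> ?R"
    moreover from this obtain r where p: "p = [:r:]"
      unfolding polynomial_ring_constants_def by blast
    ultimately have "Poly_Mapping.keys (coeff p k) \<subseteq> K k" for k
      using R_iff that by (cases k) auto
    then show "p \<in> monomial_span K" unfolding monomial_span_def by blast
  qed
  have D0: "?D 0 = ?C 0"
    by (auto intro: decomposable_0 k_cover_if_decomposable)
  {
    assume "standard_graded n ?A"
    then obtain G where G: "G \<subseteq> graded_component ?A 1" "?A = subalgebra_generated_by ?R G"
      unfolding standard_graded_def by blast
    have "?A \<subseteq> monomial_span ?D"
      unfolding G(2)
    proof (rule subalgebra_generated_by_least)
      show "subring_of (monomial_span ?D :: 'k mpoly poly set)"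
        by (rule subring_of_monomial_span)
           (auto intro: decomposable_add decomposable_0 simp: k_cover_0_iff)
      show "?R \<subseteq> monomial_span ?D" by (rule R_sub) (rule D0)
      show "G \<subseteq> monomial_span ?D"
      proof
        fix p assume "p \<in> G"
        then obtain r where p: "p \<in> monomial_span ?C" "p = monom r 1"
          using G(1) unfolding A_eq graded_component_def by blast
        have "Poly_Mapping.keys (coeff p k) \<subseteq> ?D k" for k
        proof (cases "k = 1")
          case True
          then show ?thesis
            using p(1) decomposable_1_iff unfolding monomial_span_def True by blast
        qed (simp add: p(2) coeff_monom)
        then show "p \<in> monomial_span ?D" unfolding monomial_span_def by blast
      qed
    qed
    then show ?dec
      unfolding A_eq
      by (metis (no_types, lifting) mem_Collect_eq monom_monomial_in_monomial_span_iff subsetD)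
  next
    assume dec: ?dec
    let ?G = "graded_component ?A 1"
    let ?H = "subalgebra_generated_by ?R ?G"
    note H_ring = subring_of_subalgebra_generated_by[of ?R ?G]
    have R_H: "[:r:] \<in> ?H" if "Poly_Mapping.keys r \<subseteq> ?C 0" for r
      using that R_iff subalgebra_generated_by_superset(1)[of ?R ?G] by blast
    have G_H: "monom (monomial b) 1 \<in> ?H" if "k_cover n \<Delta> w 1 b" for b
    proof -
      have "monom (monomial b) 1 \<in> ?G"
        using that unfolding graded_component_def A_eq
        by (auto simp: monom_monomial_in_monomial_span_iff)
      then show ?thesis using subalgebra_generated_by_superset(2)[of ?G ?R] by blast
    qed
    have mono_H: "monom (monomial c) k \<in> ?H" if "decomposable n \<Delta> w k c" for k c
      using that
    proof (induction rule: decomposable.induct)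
      case (decomposable_0 c)
      then show ?case using R_H[of "monomial c"] by (simp add: monomial_def monom_0)
    next
      case (decomposable_Suc b k c)
      have "monom (monomial b) 1 * monom (monomial c) k
          = (monom (monomial (b + c)) (Suc k) :: 'k mpoly poly)"
        by (simp add: monomial_def mult_monom mult_single)
      then show ?case
        using subring_of_mult[OF H_ring G_H[OF decomposable_Suc.hyps(1)] decomposable_Suc.IH]
        by simp
    qed
    have "?A = ?H"
    proof (rule antisym)
      have "[:Poly_Mapping.single 0 a:] \<in> ?H" for a
        by (rule R_H) (simp add: k_cover_0_iff)
      then have "field_constants \<subseteq> ?H"
        unfolding field_constants_def by blast
      then have "monomial_span ?C \<subseteq> ?H"
        by (rule monomial_span_least[OF H_ring]) (use dec mono_H in blast)
      then show "?A \<subseteq> ?H"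
        by (rule ord_eq_le_trans[OF A_eq])
      have "subring_of ?A"
        unfolding vertex_cover_algebra_def by (rule subring_of_subalgebra_generated_by)
      moreover have "?R \<subseteq> ?A" unfolding A_eq by (rule R_sub) simp
      moreover have "?G \<subseteq> ?A" unfolding graded_component_def by blast
      ultimately show "?H \<subseteq> ?A" by (rule subalgebra_generated_by_least)
    qed
    then show "standard_graded n ?A"
      unfolding standard_graded_def by blast
  }
qed

section \<open>Integer rounding\<close>

text \<open>Start at \<open>p\<close> and move in the direction \<open>d\<close> until for the first time a coordinate becomes an
  integer. Up to that time no coordinate crosses an integer.\<close>
lemma move_to_next_integer:
  fixes p d :: "'s \<Rightarrow> real"
  assumes "finite W" "\<And>s. s \<in> W \<Longrightarrow> p s \<in> \<int> \<Longrightarrow> d s = 0" "s0 \<in> W" "d s0 \<noteq> 0"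
  obtains t where "\<And>s. s \<in> W \<Longrightarrow> \<lfloor>p s\<rfloor> \<le> p s + t * d s \<and> p s + t * d s \<le> \<lceil>p s\<rceil>"
    and "\<exists>s\<in>W. p s \<notin> \<int> \<and> p s + t * d s \<in> \<int>"
proof -
  define N where "N = {s\<in>W. d s \<noteq> 0}"
  \<comment> \<open>The time at which coordinate \<open>s\<close> reaches the next integer in its direction of movement.\<close>
  define \<tau> where "\<tau> s = (if d s > 0 then \<lceil>p s\<rceil> - p s else \<lfloor>p s\<rfloor> - p s) / d s" for s
  define t where "t = Min (\<tau> ` N)"
  have N: "finite (\<tau> ` N)" "\<tau> ` N \<noteq> {}"
    using assms(1,3,4) unfolding N_def by auto
  have "\<tau> s \<ge> 0" if "s \<in> N" for s
    using that unfolding \<tau>_def N_def by (auto simp: divide_nonpos_nonpos)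
  then have "t \<ge> 0" unfolding t_def using N by simp
  have t_le: "t \<le> \<tau> s" if "s \<in> N" for s
    unfolding t_def using N that by simp
  show ?thesis
  proof
    fix s assume "s \<in> W"
    consider "d s = 0" | "d s > 0" | "d s < 0" by linarith
    then show "\<lfloor>p s\<rfloor> \<le> p s + t * d s \<and> p s + t * d s \<le> \<lceil>p s\<rceil>"
    proof cases
      case 2
      then have "t * d s \<le> \<lceil>p s\<rceil> - p s"
        using t_le[of s] \<open>s \<in> W\<close> by (simp add: \<tau>_def N_def pos_le_divide_eq)
      moreover have "0 \<le> t * d s" using 2 \<open>t \<ge> 0\<close> by simp
      ultimately show ?thesis using of_int_floor_le[of "p s"] by linarith
    next
      case 3
      then have "\<lfloor>p s\<rfloor> - p s \<le> t * d s"
        using t_le[of s] \<open>s \<in> W\<close> by (simp add: \<tau>_def N_def neg_le_divide_eq)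
      moreover have "t * d s \<le> 0" using 3 \<open>t \<ge> 0\<close> by (simp add: mult_nonneg_nonpos)
      ultimately show ?thesis using le_of_int_ceiling[of "p s"] by linarith
    qed (simp add: le_of_int_ceiling)
  next
    have "t \<in> \<tau> ` N" unfolding t_def using N by (rule Min_in)
    then obtain s where s: "s \<in> W" "d s \<noteq> 0" "t = \<tau> s" unfolding N_def by blast
    then have "p s + t * d s = (if d s > 0 then \<lceil>p s\<rceil> else \<lfloor>p s\<rfloor>)"
      by (simp add: \<tau>_def)
    then have "p s + t * d s \<in> \<int>" by simp
    then show "\<exists>s\<in>W. p s \<notin> \<int> \<and> p s + t * d s \<in> \<int>"
      using s assms(2) by blast
  qed
qed

text \<open>Induction on the number of coordinates and row values that are not integers. Let \<open>J\<close> be the set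
  of fractional coordinates, which may be taken nonempty, and \<open>T\<close> the set of rows with integer
  value. If the rows \<open>T\<close> have a
  kernel vector on \<open>J\<close>, moving along it preserves all values that are already integers and
  produces a new one. Otherwise some rows \<open>I \<subseteq> T\<close> form a nonsingular square system on \<open>J\<close>, which
  by hypothesis is onto over the integers. Its right-hand side is an integer vector, so its only
  solution, the restriction of \<open>x\<close> to \<open>J\<close>, is an integer vector, against the choice of \<open>J\<close>.\<close>
lemma integer_rounding:
  fixes a :: "'r \<Rightarrow> 'c \<Rightarrow> int" and x :: "'c \<Rightarrow> real"
  assumes "finite E" "finite V" "kernel_or_onto a E V"
  obtains y :: "'c \<Rightarrow> int"
  where "\<And>j. j \<in> V \<Longrightarrow> \<lfloor>x j\<rfloor> \<le> y j \<and> y j \<le> \<lceil>x j\<rceil>"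
    and "\<And>i. i \<in> E \<Longrightarrow> \<lfloor>\<Sum>j\<in>V. a i j * x j\<rfloor> \<le> (\<Sum>j\<in>V. a i j * y j)
                     \<and> (\<Sum>j\<in>V. a i j * y j) \<le> \<lceil>\<Sum>j\<in>V. a i j * x j\<rceil>"
proof -
  \<comment> \<open>Coordinates and row values are treated alike, as linear functionals indexed by a sum type.\<close>
  define L :: "('c \<Rightarrow> real) \<Rightarrow> 'c + 'r \<Rightarrow> real" where
    "L x s = (case s of Inl j \<Rightarrow> x j | Inr i \<Rightarrow> \<Sum>j\<in>V. a i j * x j)"
    for x :: "'c \<Rightarrow> real" and s
  define W where "W = V <+> E"
  have finW: "finite W" using assms by (simp add: W_def)
  have L_Inl [simp]: "L x (Inl j) = x j" and L_Inr [simp]: "L x (Inr i) = (\<Sum>j\<in>V. a i j * x j)"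
    for x :: "'c \<Rightarrow> real" and i j by (simp_all add: L_def)
  have L_linear: "L (\<lambda>j. x j + t * z j) s = L x s + t * L z s" for x z :: "'c \<Rightarrow> real" and t s
    by (cases s) (simp_all add: algebra_simps sum.distrib sum_distrib_left)
  have "\<exists>y :: 'c \<Rightarrow> int. \<forall>s\<in>W. \<lfloor>L x s\<rfloor> \<le> L (\<lambda>j. y j) s \<and> L (\<lambda>j. y j) s \<le> \<lceil>L x s\<rceil>"
  proof (induction "card {s\<in>W. L x s \<notin> \<int>}" arbitrary: x rule: less_induct)
    case less
    define J where "J = {j\<in>V. x j \<notin> \<int>}"
    define T where "T = {i\<in>E. L x (Inr i) \<in> \<int>}"
    have fin: "finite J" "finite T" and J_V: "J \<subseteq> V" and T_E: "T \<subseteq> E"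
      using assms by (auto simp: J_def T_def)
    consider "J = {}" | "has_kernel a T J"
      | I where "J \<noteq> {}" "I \<subseteq> T" "card I = card J" "\<not> has_kernel a I J"
      using kernel_or_nonsingular_rows[OF fin] by blast
    then show ?case
    proof cases
      case 1
      then have int: "real_of_int \<lfloor>x j\<rfloor> = x j" if "j \<in> V" for j
        using that unfolding J_def by (auto simp: of_int_floor)
      then have "L (\<lambda>j. \<lfloor>x j\<rfloor>) s = L x s" if "s \<in> W" for s
        using that by (cases s) (auto simp: W_def intro!: sum.cong)
      then show ?thesis
        by (intro exI[of _ "\<lambda>j. \<lfloor>x j\<rfloor>"]) (simp add: le_of_int_ceiling)
    next
      case 2
      then obtain z0 :: "'c \<Rightarrow> real" and l where z0: "l \<in> J" "z0 l \<noteq> 0"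
        "\<And>i. i \<in> T \<Longrightarrow> (\<Sum>j\<in>J. a i j * z0 j) = 0"
        unfolding has_kernel_def by blast
      define z where "z j = (if j \<in> J then z0 j else 0)" for j
      have "(\<Sum>j\<in>V. a i j * z j) = (\<Sum>j\<in>J. a i j * z0 j)" for i
        using J_V assms(2) unfolding z_def by (intro sum.mono_neutral_cong_right) auto
      then have z_int: "L z s = 0" if "s \<in> W" "L x s \<in> \<int>" for s
        using that z0(3) by (cases s) (auto simp: W_def T_def J_def z_def)
      have l: "Inl l \<in> W" "L z (Inl l) \<noteq> 0"
        using z0 J_V by (auto simp: W_def z_def)
      obtain t where t: "\<And>s. s \<in> W \<Longrightarrow> \<lfloor>L x s\<rfloor> \<le> L x s + t * L z s \<and> L x s + t * L z s \<le> \<lceil>L x s\<rceil>"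
        "\<exists>s\<in>W. L x s \<notin> \<int> \<and> L x s + t * L z s \<in> \<int>"
        using move_to_next_integer[where p = "L x" and d = "L z", OF finW z_int l] by blast
      let ?x = "\<lambda>j. x j + t * z j"
      have "{s\<in>W. L ?x s \<notin> \<int>} \<subset> {s\<in>W. L x s \<notin> \<int>}"
        using t(2) z_int unfolding L_linear by force
      then have "card {s\<in>W. L ?x s \<notin> \<int>} < card {s\<in>W. L x s \<notin> \<int>}"
        using finW by (intro psubset_card_mono) auto
      then obtain y :: "'c \<Rightarrow> int" where
        y: "\<forall>s\<in>W. \<lfloor>L ?x s\<rfloor> \<le> L (\<lambda>j. y j) s \<and> L (\<lambda>j. y j) s \<le> \<lceil>L ?x s\<rceil>"
        using less by blast
      have "\<lfloor>L x s\<rfloor> \<le> \<lfloor>L ?x s\<rfloor>" "\<lceil>L ?x s\<rceil> \<le> \<lceil>L x s\<rceil>" if "s \<in> W" for s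
        using t(1)[OF that] unfolding L_linear le_floor_iff ceiling_le_iff by blast+
      with y show ?thesis
        by (intro exI[of _ y]) (meson of_int_le_iff order_trans)
    next
      case 3
      have "int_onto a I J"
        using assms(3) 3 J_V T_E unfolding kernel_or_onto_def by blast
      moreover have "(\<Sum>j\<in>J. a i j * x j) \<in> \<int>" if "i \<in> I" for i
      proof -
        have "(\<Sum>j\<in>V. a i j * x j) = (\<Sum>j\<in>V - J. a i j * x j) + (\<Sum>j\<in>J. a i j * x j)"
          by (rule sum.subset_diff[OF J_V assms(2)])
        moreover have "(\<Sum>j\<in>V. a i j * x j) \<in> \<int>"
          using that 3(2) unfolding T_def by auto
        moreover have "(\<Sum>j\<in>V - J. a i j * x j) \<in> \<int>"
          by (intro Ints_sum Ints_mult) (auto simp: J_def)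
        ultimately show ?thesis by (metis Ints_diff add_diff_cancel_left')
      qed
      then have "\<lfloor>\<Sum>j\<in>J. a i j * x j\<rfloor> = (\<Sum>j\<in>J. a i j * x j)" if "i \<in> I" for i
        using that by (simp add: of_int_floor)
      moreover obtain y :: "'c \<Rightarrow> int" where
        y: "\<forall>i\<in>I. (\<Sum>j\<in>J. a i j * y j) = \<lfloor>\<Sum>j\<in>J. a i j * x j\<rfloor>"
        using \<open>int_onto a I J\<close> unfolding int_onto_def by meson
      ultimately have eq: "real_of_int (\<Sum>j\<in>J. a i j * y j) = (\<Sum>j\<in>J. a i j * x j)" if "i \<in> I" for i
        using that by simp
      define u where "u j = x j - y j" for j
      have "\<forall>i\<in>I. (\<Sum>j\<in>J. a i j * u j) = 0"
        using eq by (simp add: u_def right_diff_distrib sum_subtractf)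
      then have "\<forall>j\<in>J. u j = 0"
        using 3(4) unfolding has_kernel_def by blast
      then have "x j \<in> \<int>" if "j \<in> J" for j
        using that unfolding u_def by (metis Ints_of_int eq_iff_diff_eq_0)
      with 3(1) show ?thesis unfolding J_def by blast
    qed
  qed
  then obtain y :: "'c \<Rightarrow> int" where y: "\<forall>s\<in>W. \<lfloor>L x s\<rfloor> \<le> L (\<lambda>j. y j) s \<and> L (\<lambda>j. y j) s \<le> \<lceil>L x s\<rceil>"
    by blast
  show ?thesis
  proof (rule that[of y])
    fix j assume "j \<in> V"
    then show "\<lfloor>x j\<rfloor> \<le> y j \<and> y j \<le> \<lceil>x j\<rceil>"
      using bspec[OF y, of "Inl j"] by (simp add: W_def InlI)
  next
    fix i assume "i \<in> E"
    then have "\<lfloor>\<Sum>j\<in>V. a i j * x j\<rfloor> \<le> real_of_int (\<Sum>j\<in>V. a i j * y j)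
        \<and> real_of_int (\<Sum>j\<in>V. a i j * y j) \<le> \<lceil>\<Sum>j\<in>V. a i j * x j\<rceil>"
      using bspec[OF y, of "Inr i"] by (simp add: W_def InrI)
    then show "\<lfloor>\<Sum>j\<in>V. a i j * x j\<rfloor> \<le> (\<Sum>j\<in>V. a i j * y j)
        \<and> (\<Sum>j\<in>V. a i j * y j) \<le> \<lceil>\<Sum>j\<in>V. a i j * x j\<rceil>"
      unfolding of_int_le_iff .
  qed
qed

section \<open>Covers of unimodular hypergraphs decompose\<close>

lemma ex_vector:
  fixes f :: "'c \<Rightarrow> 'b::comm_monoid_add"
  assumes "finite V"
  shows "\<exists>c. Poly_Mapping.keys c \<subseteq> V \<and> Poly_Mapping.lookup c = (\<lambda>j. if j \<in> V then f j else 0)"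
proof (intro exI conjI)
  let ?c = "\<Sum>j\<in>V. Poly_Mapping.single j (f j)"
  show lookup: "Poly_Mapping.lookup ?c = (\<lambda>j. if j \<in> V then f j else 0)"
    using assms by (intro ext) (simp add: lookup_sum lookup_single when_def sum.delta')
  show "Poly_Mapping.keys ?c \<subseteq> V"
    by (auto simp: in_keys_iff lookup split: if_splits)
qed

text \<open>The part split off from a \<open>(k + 1)\<close>-cover \<open>c\<close> is a rounding of \<open>c / (k + 1)\<close>. The bounds on its
  edge sums are integers, hence survive rounding in either direction.\<close>
lemma decomposable_if_kernel_or_onto:
  assumes \<Delta>: "hypergraph n \<Delta>" and ko: "kernel_or_onto incidence \<Delta> {1..n}"
  shows "k_cover n \<Delta> w k c \<Longrightarrow> decomposable n \<Delta> w k c"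
proof (induction k arbitrary: c)
  case 0
  then show ?case by (rule decomposable_0)
next
  case (Suc k)
  let ?c = "Poly_Mapping.lookup c"
  let ?q = "1 + real k"
  obtain y :: "nat \<Rightarrow> int" where
    y: "\<And>j. j \<in> {1..n} \<Longrightarrow> \<lfloor>?c j / ?q\<rfloor> \<le> y j \<and> y j \<le> \<lceil>?c j / ?q\<rceil>"
    and y_edge: "\<And>F. F \<in> \<Delta> \<Longrightarrow> \<lfloor>\<Sum>j\<in>{1..n}. incidence F j * (?c j / ?q)\<rfloor> \<le> (\<Sum>j\<in>{1..n}. incidence F j * y j)
         \<and> (\<Sum>j\<in>{1..n}. incidence F j * y j) \<le> \<lceil>\<Sum>j\<in>{1..n}. incidence F j * (?c j / ?q)\<rceil>"
    by (rule integer_rounding[OF hypergraph_finite[OF \<Delta>] _ ko, where x = "\<lambda>j. ?c j / ?q"]) auto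
  obtain b where b: "Poly_Mapping.keys b \<subseteq> {1..n}"
      "Poly_Mapping.lookup b = (\<lambda>j. if j \<in> {1..n} then nat (y j) else 0)"
    using ex_vector[of "{1..n}" "\<lambda>j. nat (y j)", OF finite_atLeastAtMost] by blast
  have y_bounds: "0 \<le> y j" "y j \<le> ?c j" if "j \<in> {1..n}" for j
  proof -
    have "0 \<le> ?c j / ?q" by simp
    then show "0 \<le> y j" using y[OF that] by linarith
    have "?c j / ?q \<le> ?c j" by (simp add: field_simps)
    then show "y j \<le> ?c j" using y[OF that] by linarith
  qed
  have b_le: "Poly_Mapping.lookup b j \<le> ?c j" for j
    using y_bounds(2)[of j] by (simp add: b(2) nat_le_iff)
  have split: "c = b + (c - b)"
    by (rule poly_mapping_eqI) (simp add: lookup_add lookup_minus b_le)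
  have edge: "w F \<le> (\<Sum>j\<in>F. Poly_Mapping.lookup b j)"
      "k * w F + (\<Sum>j\<in>F. Poly_Mapping.lookup b j) \<le> (\<Sum>j\<in>F. ?c j)" if "F \<in> \<Delta>" for F
  proof -
    have F: "F \<subseteq> {1..n}" using \<Delta> that unfolding hypergraph_def by blast
    then have F_Int: "F \<inter> {1..n} = F" by blast
    let ?s = "\<Sum>j\<in>F. ?c j"
    have sb: "int (\<Sum>j\<in>F. Poly_Mapping.lookup b j) = (\<Sum>j\<in>F. y j)"
      using F y_bounds(1) by (auto simp: b(2) intro!: sum.cong)
    have y_F: "\<lfloor>?s / ?q\<rfloor> \<le> (\<Sum>j\<in>F. y j) \<and> (\<Sum>j\<in>F. y j) \<le> \<lceil>?s / ?q\<rceil>"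
      using y_edge[OF that] unfolding sum_incidence[OF finite_atLeastAtMost] sum_incidence_int[OF finite_atLeastAtMost] F_Int
      by (simp add: sum_divide_distrib)
    have "Suc k * w F \<le> ?s"
      using Suc.prems that unfolding k_cover_def by blast
    then have cover: "?q * w F \<le> ?s"
      by (metis of_nat_Suc of_nat_le_iff of_nat_mult)
    then have "w F \<le> ?s / ?q" by (simp add: field_simps)
    then have "int (w F) \<le> \<lfloor>?s / ?q\<rfloor>" by (simp add: le_floor_iff)
    then show "w F \<le> (\<Sum>j\<in>F. Poly_Mapping.lookup b j)"
      using y_F sb by linarith
    \<comment> \<open>With \<open>s = ?s\<close> and \<open>q = k + 1\<close>, the inequality \<open>k q w \<le> k s\<close> is \<open>s / q \<le> s - k w\<close> after division
      by \<open>q\<close>.\<close>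
    have "real k * (?q * w F) \<le> real k * real ?s"
      using cover by (rule mult_left_mono) simp
    then have "?s / ?q \<le> of_int (int ?s - int (k * w F))"
      by (simp add: field_simps)
    then have "\<lceil>?s / ?q\<rceil> \<le> int ?s - int (k * w F)" by (rule ceiling_le)
    then show "k * w F + (\<Sum>j\<in>F. Poly_Mapping.lookup b j) \<le> ?s"
      using y_F sb by linarith
  qed
  have "k_cover n \<Delta> w 1 b"
    unfolding k_cover_def using b(1) edge(1) by simp
  moreover have "k_cover n \<Delta> w k (c - b)"
    unfolding k_cover_def
  proof (intro conjI ballI)
    have "Poly_Mapping.keys (c - b) \<subseteq> Poly_Mapping.keys c"
      by (auto simp: in_keys_iff lookup_minus)
    then show "Poly_Mapping.keys (c - b) \<subseteq> {1..n}"
      using Suc.prems unfolding k_cover_def by blast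
    fix F assume "F \<in> \<Delta>"
    then show "k * w F \<le> (\<Sum>j\<in>F. Poly_Mapping.lookup (c - b) j)"
      using edge(2)[of F] by (simp add: lookup_minus sum_subtractf_nat b_le)
  qed
  ultimately show ?case
    using Suc.IH decomposable_Suc split by metis
qed

section \<open>Decomposability forces unimodularity\<close>

lemma not_has_kernelD:
  fixes x :: "'c \<Rightarrow> real"
  assumes "\<not> has_kernel a I J" "\<And>i. i \<in> I \<Longrightarrow> (\<Sum>j\<in>J. a i j * x j) = 0" "j \<in> J"
  shows "x j = 0"
  using assms unfolding has_kernel_def by blast

text \<open>An extremal argument: the violating pair is chosen with as many vertices as possible, so that the
  weights constructed from it are positive on all edges, not only on those in the pair.\<close>
lemma kernel_or_onto_if_decomposable:
  assumes \<Delta>: "hypergraph n \<Delta>"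
    and dec: "\<And>w k c. (\<forall>F\<in>\<Delta>. w F \<ge> 1) \<Longrightarrow> k_cover n \<Delta> w k c \<Longrightarrow> decomposable n \<Delta> w k c"
  shows "kernel_or_onto incidence \<Delta> {1..n}"
proof (rule ccontr)
  define bad where "bad I J \<longleftrightarrow> I \<subseteq> \<Delta> \<and> J \<subseteq> {1..n} \<and> card I = card J
      \<and> \<not> has_kernel incidence I J \<and> \<not> int_onto incidence I J" for I J
  assume "\<not> kernel_or_onto incidence \<Delta> {1..n}"
  then obtain I0 J0 where "bad I0 J0"
    unfolding kernel_or_onto_def bad_def by blast
  moreover have "\<forall>P. (case P of (I, J) \<Rightarrow> bad I J) \<longrightarrow> card (snd P) < Suc n"
    by (auto simp: bad_def less_Suc_eq_le dest!: card_mono[rotated])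
  ultimately have "\<exists>P. (case P of (I, J) \<Rightarrow> bad I J)
      \<and> (\<forall>Q. (case Q of (I, J) \<Rightarrow> bad I J) \<longrightarrow> card (snd Q) \<le> card (snd P))"
    by (intro ex_has_greatest_nat[where k = "(I0, J0)" and b = "Suc n"]) auto
  then obtain I J where bad: "bad I J" and max: "\<And>I' J'. bad I' J' \<Longrightarrow> card J' \<le> card J"
    by fastforce
  have I: "I \<subseteq> \<Delta>" and J: "J \<subseteq> {1..n}" and IJ: "card I = card J"
    and no_kernel: "\<not> has_kernel incidence I J" and not_onto: "\<not> int_onto incidence I J"
    using bad unfolding bad_def by auto
  have fin: "finite I" "finite J"
    using I J hypergraph_finite[OF \<Delta>] finite_subset by blast+
  note sum_J = sum_incidence[OF fin(2)] sum_incidence_int[OF fin(2)]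
  obtain k :: int where k: "k > 0" "\<And>b. \<exists>x. \<forall>F\<in>I. (\<Sum>j\<in>J. incidence F j * x j) = k * b F"
    using multiple_solvable_if_no_kernel[OF fin IJ no_kernel] by metis
  obtain b where "\<not> (\<exists>x. \<forall>F\<in>I. (\<Sum>j\<in>J. incidence F j * x j) = b F)"
    using not_onto unfolding int_onto_def by blast
  then have b: "\<not> (\<forall>F\<in>I. (\<Sum>j\<in>F \<inter> J. x j) = b F)" for x
    unfolding sum_J by blast
  \<comment> \<open>Otherwise row \<open>F\<close> would vanish on \<open>J\<close> and no positive value could be attained there.\<close>
  have I_meets: "F \<inter> J \<noteq> {}" if "F \<in> I" for F
  proof
    assume "F \<inter> J = {}"
    with k(2)[of "\<lambda>_. 1"] that k(1) show False unfolding sum_J by auto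
  qed
  \<comment> \<open>If \<open>J\<close> misses \<open>F\<close>, then \<open>F\<close> and any of its vertices \<open>v\<close> enlarge the violating pair: the new
    row is the unit vector at \<open>v\<close>, which makes the enlarged matrix block triangular.\<close>
  have meets: "F \<inter> J \<noteq> {}" if F: "F \<in> \<Delta>" for F
  proof
    assume disj: "F \<inter> J = {}"
    obtain G where "G \<in> I" using b by blast
    have "F \<notin> I" using I_meets disj by blast
    \<comment> \<open>An empty edge would be contained in \<open>G\<close>, and \<open>\<Delta>\<close> is a clutter.\<close>
    have "F \<noteq> {}"
    proof
      assume "F = {}"
      then have "F \<subseteq> G" by simp
      moreover have "G \<in> \<Delta>" using \<open>G \<in> I\<close> I by blast
      ultimately have "F = G" using \<Delta> F unfolding hypergraph_def by simp
      with \<open>F \<notin> I\<close> \<open>G \<in> I\<close> show False by simp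
    qed
    then obtain v where v: "v \<in> F" "v \<notin> J" using disj by blast
    have row: "(\<Sum>j\<in>H \<inter> insert v J. x j) = (if v \<in> H then x v else 0) + (\<Sum>j\<in>H \<inter> J. x j)"
      for H and x :: "nat \<Rightarrow> 'a::comm_monoid_add"
      using v(2) fin(2) by (simp add: Int_insert_right)
    have row_F: "(\<Sum>j\<in>F \<inter> insert v J. x j) = x v" for x :: "nat \<Rightarrow> 'a::comm_monoid_add"
      unfolding row using v(1) disj by simp
    have fin': "finite (insert v J)" using fin(2) by simp
    note sum_vJ = sum_incidence[OF fin'] sum_incidence_int[OF fin']
    have "\<not> has_kernel incidence (insert F I) (insert v J)"
    proof
      assume "has_kernel incidence (insert F I) (insert v J)"
      then obtain x :: "nat \<Rightarrow> real" and l where x: "l \<in> insert v J" "x l \<noteq> 0"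
        "\<And>H. H \<in> insert F I \<Longrightarrow> (\<Sum>j\<in>H \<inter> insert v J. x j) = 0"
        unfolding has_kernel_def sum_vJ by blast
      have "x v = 0" using x(3)[of F] unfolding row_F by simp
      then have "(\<Sum>j\<in>J. incidence H j * x j) = 0" if "H \<in> I" for H
        using x(3)[of H] that unfolding sum_J row by (simp split: if_splits)
      then have "x j = 0" if "j \<in> J" for j
        by (rule not_has_kernelD[OF no_kernel]) (use that in auto)
      with \<open>x v = 0\<close> x(1,2) show False by blast
    qed
    moreover have "\<not> int_onto incidence (insert F I) (insert v J)"
    proof
      assume "int_onto incidence (insert F I) (insert v J)"
      then obtain x :: "nat \<Rightarrow> int" where
        x: "\<forall>H\<in>insert F I. (\<Sum>j\<in>H \<inter> insert v J. x j) = (b(F := 0)) H"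
        unfolding int_onto_def sum_vJ by blast
      then have "x v = 0" using row_F[of x] by simp
      have "(\<Sum>j\<in>H \<inter> J. x j) = b H" if "H \<in> I" for H
      proof -
        have "(\<Sum>j\<in>H \<inter> insert v J. x j) = b H"
          using bspec[OF x, of H] that \<open>F \<notin> I\<close> by auto
        then show ?thesis
          unfolding row using \<open>x v = 0\<close> by (simp split: if_splits)
      qed
      with b[of x] show False by blast
    qed
    moreover have "v \<in> {1..n}" using \<Delta> F v(1) unfolding hypergraph_def by blast
    ultimately have "bad (insert F I) (insert v J)"
      using F I J IJ fin v(2) \<open>F \<notin> I\<close> unfolding bad_def by simp
    then have "card (insert v J) \<le> card J" by (rule max)
    with v(2) fin(2) show False by simp
  qed
  obtain x :: "nat \<Rightarrow> int" where x: "\<forall>F\<in>I. (\<Sum>j\<in>F \<inter> J. x j) = k * b F"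
    using k(2)[of b] unfolding sum_J by blast
  \<comment> \<open>The shift is by a multiple of \<open>k\<close>, so the values on \<open>I\<close> remain divisible by \<open>k\<close>; it is large
    enough to make every coordinate on \<open>J\<close> at least \<open>k\<close>, so that all weights are at least 1.\<close>
  define Y where "Y = 1 + (\<Sum>j\<in>J. \<bar>x j\<bar>)"
  have shifted: "k \<le> x j + k * Y" if "j \<in> J" for j
  proof -
    have "\<bar>x j\<bar> \<le> (\<Sum>j\<in>J. \<bar>x j\<bar>)"
      using fin(2) that by (intro member_le_sum) auto
    also have "\<dots> \<le> k * (\<Sum>j\<in>J. \<bar>x j\<bar>)"
      using k(1) mult_right_mono[of 1 k "\<Sum>j\<in>J. \<bar>x j\<bar>"] by (simp add: sum_nonneg)
    finally show ?thesis unfolding Y_def by (simp add: distrib_left)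
  qed
  define K where "K = nat k"
  obtain c where c: "Poly_Mapping.keys c \<subseteq> J"
      "Poly_Mapping.lookup c = (\<lambda>j. if j \<in> J then nat (x j + k * Y) else 0)"
    using ex_vector[OF fin(2), of "\<lambda>j. nat (x j + k * Y)"] by blast
  let ?wt = "\<lambda>c F. \<Sum>j\<in>F. Poly_Mapping.lookup c j"
  have fin_edge: "finite F" if "F \<in> \<Delta>" for F
  proof (rule finite_subset)
    show "F \<subseteq> {1..n}" using \<Delta> that unfolding hypergraph_def by blast
  qed simp
  have on_J: "?wt d F = (\<Sum>j\<in>F \<inter> J. Poly_Mapping.lookup d j)"
    if "F \<in> \<Delta>" "Poly_Mapping.keys d \<subseteq> J" for F d
    using fin_edge[OF that(1)] that(2)
    by (intro sum.mono_neutral_right) (auto simp: in_keys_iff)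
  define w where "w F = ?wt c F div K" for F
  have K: "K > 0" "int K = k" using k(1) by (simp_all add: K_def)
  have w_pos: "w F \<ge> 1" if F: "F \<in> \<Delta>" for F
  proof -
    obtain j where j: "j \<in> F \<inter> J" using meets[OF F] by blast
    have "K \<le> Poly_Mapping.lookup c j"
      using shifted[of j] j by (auto simp: c(2) K_def)
    also have "\<dots> \<le> ?wt c F"
      using j fin_edge[OF F] by (intro member_le_sum) auto
    finally show ?thesis
      using K(1) unfolding w_def by (simp add: div_greater_zero_iff Suc_le_eq)
  qed
  have "k_cover n \<Delta> w K c"
    unfolding k_cover_def using c(1) J by (auto simp: w_def)
  then have "decomposable n \<Delta> w K c"
    using dec w_pos by blast
  then obtain b1 k' d where b1: "K = Suc k'" "c = b1 + d"
    "k_cover n \<Delta> w 1 b1" "decomposable n \<Delta> w k' d"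
    using K(1) by (cases rule: decomposable.cases) auto
  have d: "k_cover n \<Delta> w k' d" using b1(4) by (rule k_cover_if_decomposable)
  have b1_J: "Poly_Mapping.keys b1 \<subseteq> J"
    using c(1) unfolding b1(2) by (auto simp: in_keys_iff lookup_add subset_iff)
  \<comment> \<open>On the edges in \<open>I\<close> the cover \<open>c\<close> has no slack, so neither has the 1-cover \<open>b1\<close>.\<close>
  have "(\<Sum>j\<in>F \<inter> J. int (Poly_Mapping.lookup b1 j) - Y) = b F" if F: "F \<in> I" for F
  proof -
    have F\<Delta>: "F \<in> \<Delta>" using F I by blast
    have "int (?wt c F) = (\<Sum>j\<in>F \<inter> J. x j + k * Y)"
      unfolding on_J[OF F\<Delta> c(1)] using shifted k(1) by (force simp: c(2) intro!: sum.cong)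
    also have "\<dots> = k * (b F + card (F \<inter> J) * Y)"
      using x F by (simp add: sum.distrib algebra_simps)
    finally have wt_c: "int (?wt c F) = k * (b F + card (F \<inter> J) * Y)" .
    then have w_F: "int (w F) = b F + card (F \<inter> J) * Y"
      unfolding w_def using k(1) K(2) by (simp add: zdiv_int)
    have "?wt c F = K * w F"
      using wt_c w_F K(2) by (metis of_nat_eq_iff of_nat_mult)
    moreover have "?wt c F = ?wt b1 F + ?wt d F"
      unfolding b1(2) by (simp add: lookup_add sum.distrib)
    moreover have "w F \<le> ?wt b1 F" "k' * w F \<le> ?wt d F"
      using b1(3) d F\<Delta> unfolding k_cover_def by auto
    ultimately have "?wt b1 F = w F"
      unfolding b1(1) by simp
    then have "(\<Sum>j\<in>F \<inter> J. int (Poly_Mapping.lookup b1 j)) = b F + card (F \<inter> J) * Y"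
      unfolding on_J[OF F\<Delta> b1_J] using w_F by (metis of_nat_sum)
    then show ?thesis by (simp add: sum_subtractf)
  qed
  with b[of "\<lambda>j. int (Poly_Mapping.lookup b1 j) - Y"] show False by blast
qed

section \<open>The characterization\<close>

theorem theorem1p1:
  fixes n :: nat and \<Delta> :: "nat set set"
  assumes "hypergraph n \<Delta>"
  shows "(\<forall>w :: nat set \<Rightarrow> nat. (\<forall>F\<in>\<Delta>. w F \<ge> 1) \<longrightarrow>
            standard_graded n (vertex_cover_algebra n \<Delta> w :: 'k::field mpoly poly set))
         \<longleftrightarrow> unimodular_hypergraph n \<Delta>"
  unfolding standard_graded_iff_decomposable unimodular_hypergraph_iff[OF assms]
  using kernel_or_onto_if_decomposable[OF assms] decomposable_if_kernel_or_onto[OF assms] by blast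

end
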